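(* Let $0\preceq_L A_1\preceq_L A_2\preceq_L\cdots\preceq_L A_n$ and $0\preceq_L B_1\preceq_L B_2\preceq_L\cdots\preceq_L B_n$ be Hermitian matrices, all of the same order, such that $A_i$ and $B_i$ commute with $A_j$ and with $B_j$ for all $i,j$. Then for all $\sigma\in S_n$, $$\prod_{i=1}^n (A_i+B_{n-i+1})\succeq_L\prod_{i=1}^n (A_i+B_{\sigma(i)})\succeq_L\prod_{i=1}^n (A_i+B_i).$$
   Context: $\preceq_L$ is the Loewner partial order on Hermitian matrices: $A\succeq_L B$ if and only if $A-B$ is positive semidefinite. Products are matrix products. $S_n$ is the symmetric group on $\{1,\dots,n\}$. *)

theory Defs
  imports "Jordan_Normal_Form.Schur_Decomposition" "HOL-Combinatorics.Permutations"
begin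

(* Squareness is implied, since dimensions are part of matrix equality. *)
definition hermitian_mat :: "complex mat \<Rightarrow> bool" where
  "hermitian_mat A \<longleftrightarrow> mat_adjoint A = A"

(* (A *\<^sub>v v) \<bullet>c v is v^* A v.  In the order on complex, 0 \<le> z means that z is real
   and nonnegative. *)
definition psd_mat :: "complex mat \<Rightarrow> bool" where
  "psd_mat A \<longleftrightarrow> hermitian_mat A \<and>
     (\<forall>v \<in> carrier_vec (dim_row A). 0 \<le> (A *\<^sub>v v) \<bullet>c v)"

(* A relation on Hermitian matrices of equal order.  The dimensions are compared explicitly
   because subtraction of matrices is total. *)
definition loewner_le :: "complex mat \<Rightarrow> complex mat \<Rightarrow> bool"  (infix \<open>\<preceq>\<^sub>L\<close> 50) where
  "A \<preceq>\<^sub>L B \<longleftrightarrow> hermitian_mat A \<and> hermitian_mat B \<and> dim_row A = dim_row B \<and> psd_mat (B - A)"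

abbreviation loewner_ge :: "complex mat \<Rightarrow> complex mat \<Rightarrow> bool"  (infix \<open>\<succeq>\<^sub>L\<close> 50) where
  "A \<succeq>\<^sub>L B \<equiv> B \<preceq>\<^sub>L A"

(* The ordered product F 1 * F 2 * ... * F n of d x d matrices.  The order d is a parameter
   since mat is not a monoid type. *)
primrec mat_prod :: "nat \<Rightarrow> (nat \<Rightarrow> complex mat) \<Rightarrow> nat \<Rightarrow> complex mat" where
  "mat_prod d F 0 = 1\<^sub>m d"
| "mat_prod d F (Suc n) = mat_prod d F n * F (Suc n)"

end

theory Submission
  imports Defs
begin

text \<open>
  A transposition that brings the factors closer to the similarly ordered arrangement lowers
  the product of two factors by \<open>(A\<^sub>j - A\<^sub>i) * (B\<^sub>l - B\<^sub>k)\<close> with \<open>i < j\<close>, \<open>k < l\<close>, a product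
  of commuting positive semidefinite matrices; every permutation is reached by such
  transpositions. That commuting positive semidefinite matrices have a positive semidefinite
  product is shown without the spectral theorem, by the iteration of F. Riesz.
\<close>

section \<open>Hermitian and positive semidefinite matrices\<close>

text \<open>The Loewner order is not compatible with multiplication in general: a product of
  positive semidefinite matrices need not even be Hermitian. Every comparison of products therefore
  takes place inside one commutative algebra, and the given family is not closed under the sums
  \<open>A i + B j\<close>, their products and the differences of these. The double commutant of the
  family is such an algebra, available without describing its elements as polynomials in the
  generators. Its positive semidefinite members form a commutative monoid, in which the ordered
  product \<open>mat_prod\<close> becomes a \<open>finprod\<close> whose factors can be regrouped
  freely. The combinatorial part sees only an abstract commutative monoid with a relation
  \<open>R\<close>. It thus serves twice: with the Loewner order for the lower bound, and with the
  converse order and the reversed sequence of the \<open>B i\<close> for the upper bound.\<close>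

lemma hermitian_mat_iff:
  "hermitian_mat A \<longleftrightarrow> dim_row A = dim_col A \<and>
     (\<forall>i < dim_row A. \<forall>j < dim_row A. A $$ (i, j) = cnj (A $$ (j, i)))"
proof -
  have "dim_row (mat_adjoint A) = dim_col A" "dim_col (mat_adjoint A) = dim_row A"
    "\<And>i j. i < dim_col A \<Longrightarrow> j < dim_row A \<Longrightarrow> mat_adjoint A $$ (i, j) = cnj (A $$ (j, i))"
    by (auto simp: mat_adjoint_def mat_of_rows_def)
  then show ?thesis
    unfolding hermitian_mat_def mat_eq_iff by metis
qed

lemma hermitian_matD:
  "hermitian_mat A \<Longrightarrow> i < dim_row A \<Longrightarrow> j < dim_row A \<Longrightarrow> A $$ (i, j) = cnj (A $$ (j, i))"
  unfolding hermitian_mat_iff by blast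

lemma hermitian_one: "hermitian_mat (1\<^sub>m d)"
  unfolding hermitian_mat_iff by auto

lemma hermitian_add:
  assumes "A \<in> carrier_mat d d" "B \<in> carrier_mat d d" "hermitian_mat A" "hermitian_mat B"
  shows "hermitian_mat (A + B)"
  using assms unfolding hermitian_mat_iff by (metis carrier_matD complex_cnj_add index_add_mat)

lemma hermitian_minus:
  assumes "A \<in> carrier_mat d d" "B \<in> carrier_mat d d" "hermitian_mat A" "hermitian_mat B"
  shows "hermitian_mat (A - B)"
  using assms unfolding hermitian_mat_iff by (metis carrier_matD complex_cnj_diff index_minus_mat)

lemma hermitian_smult:
  assumes "hermitian_mat A"
  shows "hermitian_mat (complex_of_real c \<cdot>\<^sub>m A)"
  using assms unfolding hermitian_mat_iff
  by (metis complex_cnj_complex_of_real complex_cnj_mult index_smult_mat)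

text \<open>Conjugating an entry of \<open>A * B\<close> and using the symmetry of both factors
  gives the transposed entry of \<open>B * A\<close>; commutation identifies the two
  products.\<close>

lemma hermitian_mult:
  assumes "A \<in> carrier_mat d d" "B \<in> carrier_mat d d" "hermitian_mat A" "hermitian_mat B"
    and "A * B = B * A"
  shows "hermitian_mat (A * B)"
proof -
  have "(A * B) $$ (i, j) = cnj ((A * B) $$ (j, i))" if ij: "i < d" "j < d" for i j
  proof -
    have "cnj ((A * B) $$ (j, i)) = (\<Sum>k = 0..<d. cnj (A $$ (j, k)) * cnj (B $$ (k, i)))"
      using ij assms(1,2) by (auto simp: scalar_prod_def)
    also have "\<dots> = (\<Sum>k = 0..<d. B $$ (i, k) * A $$ (k, j))"
    proof (intro sum.cong refl)
      fix k assume "k \<in> {0..<d}"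
      then have "A $$ (k, j) = cnj (A $$ (j, k))" "B $$ (i, k) = cnj (B $$ (k, i))"
        using ij assms(1-4) by (auto intro!: hermitian_matD simp del: complex_cnj_cancel_iff)
      then show "cnj (A $$ (j, k)) * cnj (B $$ (k, i)) = B $$ (i, k) * A $$ (k, j)"
        by simp
    qed
    also have "\<dots> = (B * A) $$ (i, j)"
      using ij assms(1,2) by (auto simp: scalar_prod_def)
    finally show ?thesis using assms(5) by simp
  qed
  then show ?thesis using assms(1,2) unfolding hermitian_mat_iff
    by (metis carrier_matD index_mult_mat(2,3))
qed

lemma hermitian_cscalar_prod:
  assumes A: "A \<in> carrier_mat d d" and h: "hermitian_mat A"
    and v: "v \<in> carrier_vec d" and w: "w \<in> carrier_vec d"
  shows "(A *\<^sub>v v) \<bullet>c w = v \<bullet>c (A *\<^sub>v w)"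
proof -
  have "(A *\<^sub>v v) \<bullet>c w = (\<Sum>i = 0..<d. (\<Sum>j = 0..<d. A $$ (i, j) * v $ j) * cnj (w $ i))"
    using A v w by (auto simp: scalar_prod_def)
  also have "\<dots> = (\<Sum>j = 0..<d. \<Sum>i = 0..<d. A $$ (i, j) * v $ j * cnj (w $ i))"
    by (subst sum.swap) (simp add: sum_distrib_right)
  also have "\<dots> = (\<Sum>j = 0..<d. \<Sum>i = 0..<d. v $ j * (cnj (A $$ (j, i)) * cnj (w $ i)))"
  proof (intro sum.cong refl)
    fix i j assume "i \<in> {0..<d}" "j \<in> {0..<d}"
    then have "A $$ (i, j) = cnj (A $$ (j, i))"
      using A by (intro hermitian_matD[OF h]) auto
    then show "A $$ (i, j) * v $ j * cnj (w $ i) = v $ j * (cnj (A $$ (j, i)) * cnj (w $ i))"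
      by simp
  qed
  also have "\<dots> = v \<bullet>c (A *\<^sub>v w)"
    using A v w by (auto simp: scalar_prod_def sum_distrib_left)
  finally show ?thesis .
qed

text \<open>The quadratic form of a Hermitian matrix is real, so only its real part has to be
  examined. From here on all positivity arguments are about real numbers.\<close>

lemma psd_matI:
  assumes A: "A \<in> carrier_mat d d" and h: "hermitian_mat A"
    and pos: "\<And>v. v \<in> carrier_vec d \<Longrightarrow> 0 \<le> Re ((A *\<^sub>v v) \<bullet>c v)"
  shows "psd_mat A"
proof -
  have "0 \<le> (A *\<^sub>v v) \<bullet>c v" if v: "v \<in> carrier_vec d" for v
  proof -
    have Av: "A *\<^sub>v v \<in> carrier_vec d" using A v by auto
    have "cnj ((A *\<^sub>v v) \<bullet>c v) = conjugate (A *\<^sub>v v) \<bullet> v"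
      using conjugate_sprod_vec[OF Av carrier_vec_conjugate[OF v]]
      by (simp only: conjugate_complex_def conjugate_id)
    also have "\<dots> = v \<bullet>c (A *\<^sub>v v)"
      by (rule conjugate_vec_sprod_comm[OF v Av, symmetric])
    also have "\<dots> = (A *\<^sub>v v) \<bullet>c v"
      by (rule hermitian_cscalar_prod[OF A h v v, symmetric])
    finally have "cnj ((A *\<^sub>v v) \<bullet>c v) = (A *\<^sub>v v) \<bullet>c v" .
    then have "Im ((A *\<^sub>v v) \<bullet>c v) = 0"
      by (simp add: complex_eq_iff)
    then show ?thesis using pos[OF v] by (simp add: less_eq_complex_def)
  qed
  then show ?thesis using A h unfolding psd_mat_def by auto
qed

lemma psd_matD:
  assumes "psd_mat A" "A \<in> carrier_mat d d"
  shows "hermitian_mat A" "\<And>v. v \<in> carrier_vec d \<Longrightarrow> 0 \<le> Re ((A *\<^sub>v v) \<bullet>c v)"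
  using assms unfolding psd_mat_def by (auto simp: less_eq_complex_def)

lemma psd_one: "psd_mat (1\<^sub>m d)"
  by (rule psd_matI[of _ d]) (auto simp: hermitian_one scalar_prod_def intro!: add_nonneg_nonneg sum_nonneg)

lemma cscalar_prod_add_mat:
  assumes "A \<in> carrier_mat d d" "B \<in> carrier_mat d d" "v \<in> carrier_vec d" "w \<in> carrier_vec d"
  shows "((A + B) *\<^sub>v v) \<bullet>c w = (A *\<^sub>v v) \<bullet>c w + (B *\<^sub>v v) \<bullet>c w"
  using assms add_mult_distrib_mat_vec[OF assms(1-3)] by (simp add: add_scalar_prod_distrib[of _ d])

lemma cscalar_prod_minus_mat:
  assumes "A \<in> carrier_mat d d" "B \<in> carrier_mat d d" "v \<in> carrier_vec d" "w \<in> carrier_vec d"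
  shows "((A - B) *\<^sub>v v) \<bullet>c w = (A *\<^sub>v v) \<bullet>c w - (B *\<^sub>v v) \<bullet>c w"
  using assms minus_mult_distrib_mat_vec[OF assms(1-3)] by (simp add: minus_scalar_prod_distrib[of _ d])

lemma cscalar_prod_smult_mat:
  assumes "A \<in> carrier_mat d d" "v \<in> carrier_vec d" "w \<in> carrier_vec d"
  shows "((c \<cdot>\<^sub>m A) *\<^sub>v v) \<bullet>c w = c * ((A *\<^sub>v v) \<bullet>c w)"
  using assms by (auto simp: scalar_prod_def mult.assoc simp flip: sum_distrib_left)

lemma psd_add:
  assumes "A \<in> carrier_mat d d" "B \<in> carrier_mat d d" "psd_mat A" "psd_mat B"
  shows "psd_mat (A + B)"
  using assms
  by (intro psd_matI[of _ d])
    (auto simp: cscalar_prod_add_mat psd_matD intro: hermitian_add psd_matD)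

lemma psd_smult:
  assumes "A \<in> carrier_mat d d" "psd_mat A" "0 \<le> c"
  shows "psd_mat (complex_of_real c \<cdot>\<^sub>m A)"
  using assms
  by (intro psd_matI[of _ d])
    (auto simp: cscalar_prod_smult_mat psd_matD hermitian_smult)

section \<open>Products of commuting positive semidefinite matrices\<close>

lemma psd_congruence:
  assumes X: "X \<in> carrier_mat d d" "hermitian_mat X" and B: "B \<in> carrier_mat d d" "psd_mat B"
    and herm: "hermitian_mat (X * B * X)"
  shows "psd_mat (X * B * X)"
proof (rule psd_matI[OF _ herm])
  fix v :: "complex vec" assume v: "v \<in> carrier_vec d"
  have "(X * B * X) *\<^sub>v v = X *\<^sub>v (B *\<^sub>v (X *\<^sub>v v))"
    using X(1) B(1) v by (metis assoc_mult_mat_vec mult_carrier_mat mult_mat_vec_carrier)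
  then have "((X * B * X) *\<^sub>v v) \<bullet>c v = (B *\<^sub>v (X *\<^sub>v v)) \<bullet>c (X *\<^sub>v v)"
    using hermitian_cscalar_prod[OF X, of "B *\<^sub>v (X *\<^sub>v v)" v] X(1) B(1) v by auto
  then show "0 \<le> Re (((X * B * X) *\<^sub>v v) \<bullet>c v)"
    using psd_matD(2)[OF B(2,1), of "X *\<^sub>v v"] X(1) v by auto
qed (use X B in auto)

lemma cscalar_prod_square:
  assumes "X \<in> carrier_mat d d" "hermitian_mat X" "v \<in> carrier_vec d"
  shows "((X * X) *\<^sub>v v) \<bullet>c v = (X *\<^sub>v v) \<bullet>c (X *\<^sub>v v)"
  using assms hermitian_cscalar_prod[of X d "X *\<^sub>v v" v] by (auto simp: assoc_mult_mat_vec)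

lemma cscalar_prod_self:
  "v \<in> carrier_vec d \<Longrightarrow> v \<bullet>c v = complex_of_real (\<Sum>i = 0..<d. (cmod (v $ i))\<^sup>2)"
  by (auto simp: scalar_prod_def complex_norm_square simp del: of_real_power)

text \<open>Every component of \<open>v\<close> is bounded by the norm of \<open>v\<close>, so the
  form of \<open>A\<close> at \<open>v\<close> is at most the squared norm times the sum of the
  moduli of all entries. This crude bound replaces the largest eigenvalue.\<close>

lemma psd_dominated:
  assumes A: "A \<in> carrier_mat d d" and h: "hermitian_mat A"
  obtains c where "0 < c" "psd_mat (complex_of_real c \<cdot>\<^sub>m 1\<^sub>m d - A)"
proof -
  \<comment> \<open>The summand 1 keeps \<open>c\<close> positive even for the zero matrix, so that
    one can divide by it later.\<close>
  define c where "c = 1 + (\<Sum>i = 0..<d. \<Sum>j = 0..<d. cmod (A $$ (i, j)))"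
  have c: "0 < c" unfolding c_def
    by (intro add_pos_nonneg) (auto intro!: sum_nonneg)
  have "psd_mat (complex_of_real c \<cdot>\<^sub>m 1\<^sub>m d - A)"
  proof (rule psd_matI[of _ d])
    show "hermitian_mat (complex_of_real c \<cdot>\<^sub>m 1\<^sub>m d - A)"
      using A h by (intro hermitian_minus[of _ d] hermitian_smult hermitian_one) auto
    fix v :: "complex vec" assume v: "v \<in> carrier_vec d"
    define N where "N = (\<Sum>i = 0..<d. (cmod (v $ i))\<^sup>2)"
    have N: "0 \<le> N" unfolding N_def by (intro sum_nonneg) auto
    have vv: "v \<bullet>c v = complex_of_real N"
      unfolding N_def by (rule cscalar_prod_self[OF v])
    have vi: "cmod (v $ i) \<le> sqrt N" if "i < d" for i
      unfolding N_def using that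
      by (intro real_le_rsqrt member_le_sum[of i "{0..<d}" "\<lambda>i. (cmod (v $ i))\<^sup>2"]) auto
    have "cmod ((A *\<^sub>v v) \<bullet>c v) = cmod (\<Sum>i = 0..<d. \<Sum>j = 0..<d. A $$ (i, j) * v $ j * cnj (v $ i))"
      using A v by (auto simp: scalar_prod_def sum_distrib_right)
    also have "\<dots> \<le> (\<Sum>i = 0..<d. \<Sum>j = 0..<d. cmod (A $$ (i, j)) * N)"
    proof (intro sum_norm_le)
      fix i j assume ij: "i \<in> {0..<d}" "j \<in> {0..<d}"
      have "cmod (v $ j) * cmod (v $ i) \<le> sqrt N * sqrt N"
        using ij by (intro mult_mono vi) (auto simp: N)
      then show "cmod (A $$ (i, j) * v $ j * cnj (v $ i)) \<le> cmod (A $$ (i, j)) * N"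
        using N by (simp add: norm_mult mult.assoc mult_left_mono)
    qed
    also have "\<dots> = (c - 1) * N"
      unfolding c_def by (simp add: sum_distrib_right)
    also have "\<dots> \<le> c * N" using N by (simp add: algebra_simps)
    finally have "Re ((A *\<^sub>v v) \<bullet>c v) \<le> c * N"
      using complex_Re_le_cmod order_trans by blast
    then show "0 \<le> Re (((complex_of_real c \<cdot>\<^sub>m 1\<^sub>m d - A) *\<^sub>v v) \<bullet>c v)"
      using A v by (simp add: cscalar_prod_minus_mat[of _ d] cscalar_prod_smult_mat[of _ d] vv)
  qed (use A in auto)
  with c show ?thesis by (rule that)
qed


text \<open>With \<open>Y = 1\<^sub>m d - X\<close> the matrix in question is \<open>X * Y\<close>,
  and since \<open>X + Y\<close> is the identity it equals
  \<open>X * Y * (X + Y) = X * Y * X + Y * X * Y\<close>. Both summands are congruences of positive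
  semidefinite matrices.\<close>

lemma psd_minus_square:
  assumes X: "X \<in> carrier_mat d d" and p: "psd_mat X" and q: "psd_mat (1\<^sub>m d - X)"
  shows "psd_mat (X - X * X)"
proof -
  note h = psd_matD(1)[OF p X]
  define Y where "Y = 1\<^sub>m d - X"
  have Y: "Y \<in> carrier_mat d d" and hY: "hermitian_mat Y"
    using X psd_matD(1)[OF q minus_carrier_mat[OF X]] minus_carrier_mat[OF X] by (auto simp: Y_def)
  have XX: "hermitian_mat (X * X)" using X h by (intro hermitian_mult) auto
  have XY: "X * Y = X - X * X" "Y * X = X - X * X"
    using X by (simp_all add: Y_def mult_minus_distrib_mat[of _ d d _ d] minus_mult_distrib_mat[of _ d d _ _ d])
  have hXY: "hermitian_mat (X * Y)" using X h XX by (simp add: XY hermitian_minus[of _ d])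
  have comm: "Y * X = X * Y" using XY by simp
  \<comment> \<open>Read as commutation of \<open>X\<close> with \<open>X * Y\<close> and of
    \<open>Y\<close> with \<open>Y * X\<close>, these are the equations that
    \<open>hermitian_mult\<close> asks for.\<close>
  have "X * Y * X = X * (X * Y)" "Y * X * Y = Y * (Y * X)"
    using X Y comm by (metis assoc_mult_mat)+
  then have hXYX: "hermitian_mat (X * Y * X)" and hYXY: "hermitian_mat (Y * X * Y)"
    using X Y h hY hXY comm hermitian_mult[of "X * Y" d X] hermitian_mult[of "Y * X" d Y] by auto
  have "psd_mat (X * Y * X + Y * X * Y)"
    using X Y h hY p q hXYX hYXY by (intro psd_add[of _ d] psd_congruence[of _ d]) (auto simp: Y_def)
  moreover have "X * Y * X + Y * X * Y = X - X * X"
  proof -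
    have "X * Y * X + Y * X * Y = X * Y * X + X * Y * Y"
      using XY by simp
    also have "\<dots> = X * Y * (X + Y)"
      using X Y by (intro mult_add_distrib_mat[symmetric]) auto
    also have "X + Y = 1\<^sub>m d"
      using X by (auto simp: Y_def intro!: eq_matI)
    finally show ?thesis using X Y XY by simp
  qed
  ultimately show ?thesis by simp
qed

text \<open>
  The iterates of \<open>Y \<mapsto> Y - Y\<^sup>2\<close> started at \<open>X\<close> stay between \<open>0\<close> and \<open>1\<close>. Since
  \<open>Y\<^sub>k B = Y\<^sub>k B Y\<^sub>k + Y\<^sub>k\<^sub>+\<^sub>1 B\<close>, the quadratic form of \<open>Y\<^sub>k B\<close> decreases in \<open>k\<close>, and telescoping
  gives \<open>\<Sum>\<^sub>k \<parallel>Y\<^sub>k v\<parallel>\<^sup>2 \<le> \<langle>X v, v\<rangle>\<close>, so that it tends to \<open>0\<close>.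
\<close>

lemma commuting_psd_mult_unit:
  assumes X: "X \<in> carrier_mat d d" and p: "psd_mat X" and q: "psd_mat (1\<^sub>m d - X)"
    and B: "B \<in> carrier_mat d d" and pB: "psd_mat B" and comm: "X * B = B * X"
  shows "psd_mat (X * B)"
proof -
  define Y where "Y k = ((\<lambda>Z. Z - Z * Z) ^^ k) X" for k
  have Y_0: "Y 0 = X" and Y_Suc: "Y (Suc k) = Y k - Y k * Y k" for k
    by (simp_all add: Y_def)
  have inv: "Y k \<in> carrier_mat d d \<and> psd_mat (Y k) \<and> psd_mat (1\<^sub>m d - Y k) \<and> Y k * B = B * Y k" for k
  proof (induction k)
    case 0
    then show ?case using X p q comm by (simp add: Y_0)
  next
    case (Suc k)
    define Z where "Z = Y k"
    have Z: "Z \<in> carrier_mat d d" "psd_mat Z" "psd_mat (1\<^sub>m d - Z)" "Z * B = B * Z"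
      using Suc by (auto simp: Z_def)
    note h = psd_matD(1)[OF Z(2,1)]
    \<comment> \<open>The square of \<open>Z\<close> is a congruence of the identity. The upper
      bound survives the iteration because \<open>1 - (Z - Z * Z)\<close> is the sum of
      \<open>1 - Z\<close> and this square.\<close>
    have "psd_mat (Z * 1\<^sub>m d * Z)"
      using Z h hermitian_mult[of Z d Z]
      by (intro psd_congruence[of _ d]) (auto simp: psd_one)
    then have "psd_mat (1\<^sub>m d - Z + Z * Z)"
      using Z by (intro psd_add[of _ d]) auto
    moreover have "1\<^sub>m d - (Z - Z * Z) = 1\<^sub>m d - Z + Z * Z"
      using Z(1) by (intro eq_matI) (auto simp del: index_mult_mat(1))
    moreover have "(Z - Z * Z) * B = B * (Z - Z * Z)"
    proof -
      have "Z * Z * B = B * (Z * Z)"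
        using Z(1,4) B by (metis assoc_mult_mat)
      then show ?thesis
        using Z(1,4) B by (simp add: mult_minus_distrib_mat[of _ d d _ d] minus_mult_distrib_mat[of _ d d _ _ d])
    qed
    ultimately show ?case
      using Z psd_minus_square[OF Z(1-3)] minus_carrier_mat[of "Z * Z" d d Z]
      unfolding Y_Suc Z_def[symmetric] by simp
  qed
  note Y = inv[THEN conjunct1] and pY = inv[THEN conjunct2, THEN conjunct1]
    and cY = inv[THEN conjunct2, THEN conjunct2, THEN conjunct2]
  note hY = psd_matD(1)[OF pY Y] and hB = psd_matD(1)[OF pB B]
  have herm: "hermitian_mat (X * B)"
    using hermitian_mult[OF Y B hY hB cY, of 0] by (simp add: Y_0)
  show ?thesis
  proof (rule psd_matI[OF _ herm])
    fix v :: "complex vec" assume v: "v \<in> carrier_vec d"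
    define b where "b k = Re (((Y k * B) *\<^sub>v v) \<bullet>c v)" for k
    define s where "s k = Re ((Y k *\<^sub>v v) \<bullet>c v)" for k
    define e where "e k = Re ((Y k *\<^sub>v v) \<bullet>c (Y k *\<^sub>v v))" for k
    have s_step: "s (Suc k) = s k - e k" for k
      unfolding s_def e_def Y_Suc using Y[of k] v cscalar_prod_square[OF Y hY v, of k]
      by (simp add: cscalar_prod_minus_mat[of _ d])
    have s_nonneg: "0 \<le> s k" for k
      unfolding s_def by (rule psd_matD(2)[OF pY Y v])
    have e_eq: "e k = (\<Sum>i = 0..<d. (cmod ((Y k *\<^sub>v v) $ i))\<^sup>2)" for k
      unfolding e_def using cscalar_prod_self[OF mult_mat_vec_carrier[OF Y v]] by simp
    have e_nonneg: "0 \<le> e k" for k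
      unfolding e_eq by (intro sum_nonneg) auto
    have "(\<Sum>k<m. e k) = s 0 - s m" for m
      by (induction m) (auto simp: s_step)
    then have "summable e"
      using e_nonneg s_nonneg by (intro summableI_nonneg_bounded[of e "s 0"]) auto
    then have e_lim: "e \<longlonglongrightarrow> 0" by (rule summable_LIMSEQ_zero)
    have b_step: "b (Suc k) \<le> b k" for k
    proof -
      have YBY: "Y k * B * Y k = (Y k * Y k) * B"
        using Y B cY by (metis assoc_mult_mat)
      have "hermitian_mat (Y k * B * Y k)"
      proof -
        have "(Y k * Y k) * B = B * (Y k * Y k)"
          using Y B cY by (metis assoc_mult_mat)
        then show ?thesis unfolding YBY using Y B hY hB
          by (intro hermitian_mult[of "Y k * Y k" d B] hermitian_mult[OF Y Y] mult_carrier_mat[OF Y Y]) auto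
      qed
      then have "psd_mat (Y k * Y k * B)"
        using psd_congruence[OF Y hY B pB] YBY by metis
      then have "0 \<le> Re (((Y k * Y k * B) *\<^sub>v v) \<bullet>c v)"
        using Y[of k] B v by (intro psd_matD) auto
      moreover have "Y (Suc k) * B = Y k * B - Y k * Y k * B"
        unfolding Y_Suc using Y[of k] B by (intro minus_mult_distrib_mat) auto
      ultimately show ?thesis
        unfolding b_def using Y[of k] B v by (simp add: cscalar_prod_minus_mat[of _ d])
    qed
    have b_mono: "b k \<le> b 0" for k
      by (induction k) (use b_step order_trans in auto)
    \<comment> \<open>The summability above controls \<open>Y k *\<^sub>v v\<close>, not yet
      \<open>b\<close>. Moving \<open>Y k\<close> to the other side of the inner product turns
      \<open>b k\<close> into the pairing of the fixed vector \<open>B *\<^sub>v v\<close> with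
      \<open>Y k *\<^sub>v v\<close>, a finite sum, so convergence of each component is
      enough.\<close>
    have "b \<longlonglongrightarrow> 0"
    proof -
      have comp: "(\<lambda>k. (Y k *\<^sub>v v) $ i) \<longlonglongrightarrow> 0" if i: "i < d" for i
      proof -
        have "(cmod ((Y k *\<^sub>v v) $ i))\<^sup>2 \<le> e k" for k
          unfolding e_eq using i by (intro member_le_sum[of i "{0..<d}" "\<lambda>i. (cmod ((Y k *\<^sub>v v) $ i))\<^sup>2"]) auto
        then have "(\<lambda>k. (cmod ((Y k *\<^sub>v v) $ i))\<^sup>2) \<longlonglongrightarrow> 0"
          by (intro tendsto_sandwich[OF _ _ tendsto_const e_lim]) auto
        then have "(\<lambda>k. sqrt ((cmod ((Y k *\<^sub>v v) $ i))\<^sup>2)) \<longlonglongrightarrow> sqrt 0"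
          by (rule tendsto_real_sqrt)
        then show ?thesis by (simp add: tendsto_norm_zero_iff)
      qed
      have "b = (\<lambda>k. Re (\<Sum>i = 0..<d. (B *\<^sub>v v) $ i * cnj ((Y k *\<^sub>v v) $ i)))"
      proof
        fix k
        have "((Y k * B) *\<^sub>v v) \<bullet>c v = (B *\<^sub>v v) \<bullet>c (Y k *\<^sub>v v)"
          using hermitian_cscalar_prod[OF Y hY, of "B *\<^sub>v v" v k] Y[of k] B v by auto
        then show "b k = Re (\<Sum>i = 0..<d. (B *\<^sub>v v) $ i * cnj ((Y k *\<^sub>v v) $ i))"
          unfolding b_def using Y[of k] B v by (simp add: scalar_prod_def del: index_mult_mat_vec)
      qed
      moreover have "(\<lambda>k. Re (\<Sum>i = 0..<d. (B *\<^sub>v v) $ i * cnj ((Y k *\<^sub>v v) $ i)))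
          \<longlonglongrightarrow> Re (\<Sum>i = 0..<d. (B *\<^sub>v v) $ i * cnj 0)"
        by (intro tendsto_intros comp) auto
      ultimately show ?thesis by simp
    qed
    \<comment> \<open>A decreasing sequence starts no lower than its limit.\<close>
    then have "0 \<le> b 0"
      using b_mono by (intro LIMSEQ_le_const2) auto
    then show "0 \<le> Re (((X * B) *\<^sub>v v) \<bullet>c v)"
      by (simp add: b_def Y_0)
  qed (use X B in auto)
qed

text \<open>The claim is invariant under positive scaling of \<open>A\<close>. Dividing by a bound
  \<open>c\<close> with \<open>A\<close> below \<open>c\<close> times the identity brings
  \<open>A\<close> between 0 and 1, where the iteration applies.\<close>

lemma commuting_psd_mult:
  assumes A: "A \<in> carrier_mat d d" "psd_mat A" and B: "B \<in> carrier_mat d d" "psd_mat B"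
    and comm: "A * B = B * A"
  shows "psd_mat (A * B)"
proof -
  obtain c where c: "0 < c" and dom: "psd_mat (complex_of_real c \<cdot>\<^sub>m 1\<^sub>m d - A)"
    using psd_dominated[OF A(1) psd_matD(1)[OF A(2,1)]] .
  define X where "X = complex_of_real (1 / c) \<cdot>\<^sub>m A"
  have X: "X \<in> carrier_mat d d" and AX: "A = complex_of_real c \<cdot>\<^sub>m X"
    using A(1) c by (auto simp: X_def intro!: eq_matI)
  have pX: "psd_mat X"
    unfolding X_def using A c by (intro psd_smult) auto
  have "1\<^sub>m d - X = complex_of_real (1 / c) \<cdot>\<^sub>m (complex_of_real c \<cdot>\<^sub>m 1\<^sub>m d - A)"
    using A(1) c by (auto simp: X_def field_simps intro!: eq_matI)
  moreover have "psd_mat (complex_of_real (1 / c) \<cdot>\<^sub>m (complex_of_real c \<cdot>\<^sub>m 1\<^sub>m d - A))"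
    using A c dom by (intro psd_smult[of _ d]) auto
  ultimately have qX: "psd_mat (1\<^sub>m d - X)" by simp
  have "X * B = B * X"
    unfolding X_def using A B comm
    by (simp add: mult_smult_assoc_mat[of _ d d _ d] mult_smult_distrib[of _ d d _ d])
  then have "psd_mat (X * B)"
    by (rule commuting_psd_mult_unit[OF X pX qX B])
  then have "psd_mat (complex_of_real c \<cdot>\<^sub>m (X * B))"
    using X B c by (intro psd_smult[of _ d]) auto
  moreover have "A * B = complex_of_real c \<cdot>\<^sub>m (X * B)"
    unfolding AX using X B by (intro mult_smult_assoc_mat) auto
  ultimately show ?thesis by simp
qed

section \<open>Rearrangement by transpositions\<close>

text \<open>Induction on the last position \<open>m\<close>. If \<sigma> does not fix
  \<open>m\<close>, one exchange of two factors sends the value \<open>m\<close> home, and the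
  resulting permutation, fixing \<open>m\<close>, reduces to the smaller index set. Hence
  \<open>swap\<close> speaks only of exchanges that restore the largest position to its own
  value.\<close>

lemma (in comm_monoid) finprod_rearrangement:
  fixes F :: "nat \<Rightarrow> nat \<Rightarrow> 'a" and R :: "'a \<Rightarrow> 'a \<Rightarrow> bool"
  assumes refl: "\<And>x. x \<in> carrier G \<Longrightarrow> R x x"
    and trans: "\<And>x y z. \<lbrakk>x \<in> carrier G; y \<in> carrier G; z \<in> carrier G; R x y; R y z\<rbrakk> \<Longrightarrow> R x z"
    and mult: "\<And>x y z. \<lbrakk>x \<in> carrier G; y \<in> carrier G; z \<in> carrier G; R x y\<rbrakk> \<Longrightarrow> R (z \<otimes> x) (z \<otimes> y)"
    and F: "\<And>i j. i \<in> {1..n} \<Longrightarrow> j \<in> {1..n} \<Longrightarrow> F i j \<in> carrier G"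
    and swap: "\<And>i k m. \<lbrakk>i \<in> {1..<m}; k \<in> {1..<m}; m \<in> {1..n}\<rbrakk>
      \<Longrightarrow> R (F i k \<otimes> F m m) (F i m \<otimes> F m k)"
    and \<sigma>: "\<sigma> permutes {1..n}"
  shows "R (finprod G (\<lambda>i. F i i) {1..n}) (finprod G (\<lambda>i. F i (\<sigma> i)) {1..n})"
  using F swap \<sigma>
proof (induction n arbitrary: \<sigma>)
  case 0
  then show ?case by (simp add: refl)
next
  case (Suc n)
  define m where "m = Suc n"
  note F = Suc.prems(1)[folded m_def] and swap = Suc.prems(2)[folded m_def]
    and \<sigma> = Suc.prems(3)[folded m_def]
  have m: "m \<in> {1..m}" by (simp add: m_def)
  have ins: "{1..m} = insert m {1..n}" "m \<notin> {1..n}" by (auto simp: m_def)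
  have mem: "F i (\<tau> i) \<in> carrier G" if "\<tau> permutes {1..m}" "i \<in> {1..m}" for \<tau> i
    using F that permutes_in_image[OF that(1)] by blast
  have fixed: "R (finprod G (\<lambda>i. F i i) {1..m}) (finprod G (\<lambda>i. F i (\<tau> i)) {1..m})"
    if \<tau>: "\<tau> permutes {1..m}" and \<tau>m: "\<tau> m = m" for \<tau>
  proof -
    have "\<tau> permutes {1..n}"
      using \<tau>m ins by (intro permutes_superset[OF \<tau>]) auto
    then have IH: "R (finprod G (\<lambda>i. F i i) {1..n}) (finprod G (\<lambda>i. F i (\<tau> i)) {1..n})"
      using F swap by (intro Suc.IH) (auto simp: m_def)
    have 1: "finprod G (\<lambda>i. F i i) {1..m} = F m m \<otimes> finprod G (\<lambda>i. F i i) {1..n}"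
      unfolding ins(1) using ins(2) F by (intro finprod_insert) (auto simp: m_def)
    have 2: "finprod G (\<lambda>i. F i (\<tau> i)) {1..m} = F m m \<otimes> finprod G (\<lambda>i. F i (\<tau> i)) {1..n}"
      unfolding ins(1) using ins(2) mem[OF \<tau>] F[OF m m] \<tau>m finprod_insert[of "{1..n}" m "\<lambda>i. F i (\<tau> i)"]
      by (auto simp: m_def Pi_def)
    show ?thesis unfolding 1 2
      using IH F mem[OF \<tau>] m by (intro mult finprod_closed) (auto simp: m_def)
  qed
  have "R (finprod G (\<lambda>i. F i i) {1..m}) (finprod G (\<lambda>i. F i (\<sigma> i)) {1..m})"
  proof (cases "\<sigma> m = m")
    case True
    then show ?thesis using fixed \<sigma> by blast
  next
    case False
    define k where "k = \<sigma> m"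
    obtain j where \<sigma>j: "\<sigma> j = m"
      using permutes_surj[OF \<sigma>] by (metis surjD)
    define \<tau> where "\<tau> = Transposition.transpose m k \<circ> \<sigma>"
    have k: "k \<in> {1..<m}" using permutes_in_image[OF \<sigma>, of m] m False by (auto simp: k_def)
    have "j \<in> {1..m}" using permutes_in_image[OF \<sigma>, of j] \<sigma>j m by simp
    then have j: "j \<in> {1..<m}" using \<sigma>j False by (cases "j = m") auto
    have \<tau>: "\<tau> permutes {1..m}"
      unfolding \<tau>_def using \<sigma> k m by (intro permutes_compose permutes_swap_id) auto
    have \<tau>v: "\<tau> m = m" "\<tau> j = k" by (simp_all add: \<tau>_def k_def \<sigma>j)
    have \<tau>_eq: "\<tau> i = \<sigma> i" if "i \<noteq> m" "i \<noteq> j" for i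
    proof -
      have "\<sigma> i \<noteq> m" "\<sigma> i \<noteq> k"
        using that \<sigma>j k_def permutes_inj[OF \<sigma>] by (metis injD)+
      then show ?thesis by (simp add: \<tau>_def)
    qed
    \<comment> \<open>The products for \<sigma> and \<tau> agree on \<open>S\<close>. This common
      part is split off, so that \<open>swap\<close> acts on the two remaining factors and
      \<open>mult\<close> restores the rest.\<close>
    define S where "S = {1..m} - {j, m}"
    have S: "{1..m} = insert j (insert m S)" "finite S" "j \<notin> insert m S" "m \<notin> S"
      using j m by (auto simp: S_def)
    have split: "finprod G (\<lambda>i. F i (\<rho> i)) {1..m}
        = finprod G (\<lambda>i. F i (\<rho> i)) S \<otimes> (F j (\<rho> j) \<otimes> F m (\<rho> m))"
      if \<rho>: "\<rho> permutes {1..m}" for \<rho>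
    proof -
      have c: "F j (\<rho> j) \<in> carrier G" "F m (\<rho> m) \<in> carrier G"
        "(\<lambda>i. F i (\<rho> i)) \<in> S \<rightarrow> carrier G"
        using mem[OF \<rho>] j m by (auto simp: S_def)
      then show ?thesis
        unfolding S(1) using S(2-4) by (simp add: m_ac)
    qed
    have P: "finprod G (\<lambda>i. F i (\<tau> i)) S = finprod G (\<lambda>i. F i (\<sigma> i)) S"
      using mem[OF \<sigma>] \<tau>_eq by (intro finprod_cong') (auto simp: S_def)
    have "R (F j k \<otimes> F m m) (F j m \<otimes> F m k)"
      using swap j k m by blast
    then have "R (finprod G (\<lambda>i. F i (\<tau> i)) {1..m}) (finprod G (\<lambda>i. F i (\<sigma> i)) {1..m})"
      unfolding split[OF \<tau>] split[OF \<sigma>] P \<tau>v \<sigma>j k_def[symmetric]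
      using F mem[OF \<sigma>] j k m by (intro mult m_closed finprod_closed) (auto simp: S_def)
    moreover have "finprod G (\<lambda>i. F i i) {1..m} \<in> carrier G"
      "finprod G (\<lambda>i. F i (\<tau> i)) {1..m} \<in> carrier G" "finprod G (\<lambda>i. F i (\<sigma> i)) {1..m} \<in> carrier G"
      using F mem[OF \<tau>] mem[OF \<sigma>] by (auto intro!: finprod_closed)
    ultimately show ?thesis using fixed[OF \<tau> \<tau>v(1)] trans by blast
  qed
  then show ?case by (simp add: m_def)
qed

section \<open>The positive cone of a commuting family\<close>

text \<open>The restriction to \<open>carrier_mat d d\<close> puts every commutant among the square
  matrices of order \<open>d\<close>, whatever \<open>S\<close> is; the closure lemmas below then
  apply to the double commutant unconditionally.\<close>

definition commutant :: "nat \<Rightarrow> complex mat set \<Rightarrow> complex mat set" where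
  "commutant d S = {M \<in> carrier_mat d d. \<forall>X \<in> S. M * X = X * M}"

text \<open>The double commutant of a commuting family is a commutative algebra containing it.\<close>

definition psd_cone :: "nat \<Rightarrow> complex mat set \<Rightarrow> complex mat monoid" where
  "psd_cone d S =
     \<lparr>carrier = {M \<in> commutant d (commutant d S). psd_mat M}, monoid.mult = (*), monoid.one = 1\<^sub>m d\<rparr>"

lemma psd_cone_simps [simp]:
  "monoid.mult (psd_cone d S) = (*)" "monoid.one (psd_cone d S) = 1\<^sub>m d"
  by (simp_all add: psd_cone_def)

lemma carrier_psd_cone:
  "carrier (psd_cone d S) = {M \<in> commutant d (commutant d S). psd_mat M}"
  by (simp add: psd_cone_def)

lemma psd_coneD:
  assumes "M \<in> carrier (psd_cone d S)"
  shows "M \<in> carrier_mat d d" "psd_mat M" "hermitian_mat M" "M \<in> commutant d (commutant d S)"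
  using assms psd_matD(1) by (auto simp: carrier_psd_cone commutant_def)

lemma commutant_mult:
  assumes S: "S \<subseteq> carrier_mat d d" and M: "M \<in> commutant d S" and N: "N \<in> commutant d S"
  shows "M * N \<in> commutant d S"
proof -
  have "M * N * X = X * (M * N)" if "X \<in> S" for X
  proof -
    have c: "X \<in> carrier_mat d d" "M \<in> carrier_mat d d" "N \<in> carrier_mat d d"
      and e: "M * X = X * M" "N * X = X * N"
      using that S M N by (auto simp: commutant_def)
    have "M * N * X = M * (X * N)" using c e by simp
    also have "\<dots> = X * M * N" using c e(1) by (simp flip: assoc_mult_mat[of M d d X d N d])
    finally show ?thesis using c by simp
  qed
  then show ?thesis using M N by (auto simp: commutant_def)
qed

lemma commutant_add:
  assumes S: "S \<subseteq> carrier_mat d d" and M: "M \<in> commutant d S" and N: "N \<in> commutant d S"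
  shows "M + N \<in> commutant d S"
proof -
  have "(M + N) * X = X * (M + N)" if "X \<in> S" for X
  proof -
    have "X \<in> carrier_mat d d" "M \<in> carrier_mat d d" "N \<in> carrier_mat d d"
      "M * X = X * M" "N * X = X * N"
      using that S M N by (auto simp: commutant_def)
    then show ?thesis
      by (simp add: add_mult_distrib_mat[of _ d d _ _ d] mult_add_distrib_mat[of _ d d _ d])
  qed
  then show ?thesis using M N by (auto simp: commutant_def)
qed

lemma commutant_minus:
  assumes S: "S \<subseteq> carrier_mat d d" and M: "M \<in> commutant d S" and N: "N \<in> commutant d S"
  shows "M - N \<in> commutant d S"
proof -
  have "(M - N) * X = X * (M - N)" if "X \<in> S" for X
  proof -
    have "X \<in> carrier_mat d d" "M \<in> carrier_mat d d" "N \<in> carrier_mat d d"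
      "M * X = X * M" "N * X = X * N"
      using that S M N by (auto simp: commutant_def)
    then show ?thesis
      by (simp add: minus_mult_distrib_mat[of _ d d _ _ d] mult_minus_distrib_mat[of _ d d _ d])
  qed
  then show ?thesis using M N minus_carrier_mat[of N d d M] by (auto simp: commutant_def)
qed

lemma commutant_carrier: "commutant d S \<subseteq> carrier_mat d d"
  by (auto simp: commutant_def)

lemma commutant_one: "S \<subseteq> carrier_mat d d \<Longrightarrow> 1\<^sub>m d \<in> commutant d S"
  by (auto simp: commutant_def)

text \<open>The single inclusion says both that the members of \<open>S\<close> have order
  \<open>d\<close> and that they commute pairwise.\<close>

locale commuting_family =
  fixes d :: nat and S :: "complex mat set"
  assumes family: "S \<subseteq> commutant d S"
begin

text \<open>Taking commutants reverses inclusions, so a family contained in its commutant has its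
  double commutant contained there as well. Everything in the double commutant commutes with that
  commutant by definition.\<close>

lemma double_commutant_comm:
  assumes "M \<in> commutant d (commutant d S)" "N \<in> commutant d (commutant d S)"
  shows "M * N = N * M"
proof -
  have "N \<in> commutant d S"
    using assms(2) family by (auto simp: commutant_def)
  then show ?thesis using assms(1) by (auto simp: commutant_def)
qed

lemma in_double_commutant: "M \<in> S \<Longrightarrow> M \<in> commutant d (commutant d S)"
  using family by (auto simp: commutant_def)

lemma psd_cone_add:
  assumes "M \<in> carrier (psd_cone d S)" "N \<in> carrier (psd_cone d S)"
  shows "M + N \<in> carrier (psd_cone d S)"
  using assms psd_coneD[OF assms(1)] psd_coneD[OF assms(2)]
  by (auto simp: carrier_psd_cone intro: commutant_add[OF commutant_carrier] psd_add)

lemma psd_cone_mult: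
  assumes "M \<in> carrier (psd_cone d S)" "N \<in> carrier (psd_cone d S)"
  shows "M * N \<in> carrier (psd_cone d S)"
  using psd_coneD[OF assms(1)] psd_coneD[OF assms(2)] double_commutant_comm[of M N]
  by (auto simp: carrier_psd_cone intro: commutant_mult[OF commutant_carrier] commuting_psd_mult)

sublocale comm_monoid "psd_cone d S"
proof (rule comm_monoidI)
  show "\<one>\<^bsub>psd_cone d S\<^esub> \<in> carrier (psd_cone d S)"
    by (simp add: carrier_psd_cone psd_one commutant_one commutant_carrier)
  fix x y z
  assume xyz: "x \<in> carrier (psd_cone d S)" "y \<in> carrier (psd_cone d S)" "z \<in> carrier (psd_cone d S)"
  show "x \<otimes>\<^bsub>psd_cone d S\<^esub> y \<otimes>\<^bsub>psd_cone d S\<^esub> z = x \<otimes>\<^bsub>psd_cone d S\<^esub> (y \<otimes>\<^bsub>psd_cone d S\<^esub> z)"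
    using xyz[THEN psd_coneD(1)] by simp
next
  fix x y
  assume xy: "x \<in> carrier (psd_cone d S)" "y \<in> carrier (psd_cone d S)"
  show "x \<otimes>\<^bsub>psd_cone d S\<^esub> y \<in> carrier (psd_cone d S)"
    using psd_cone_mult[OF xy] by simp
  show "x \<otimes>\<^bsub>psd_cone d S\<^esub> y = y \<otimes>\<^bsub>psd_cone d S\<^esub> x"
    using double_commutant_comm xy[THEN psd_coneD(4)] by simp
next
  fix x assume "x \<in> carrier (psd_cone d S)"
  then show "\<one>\<^bsub>psd_cone d S\<^esub> \<otimes>\<^bsub>psd_cone d S\<^esub> x = x"
    using psd_coneD(1) by fastforce
qed

text \<open>\<open>mat_prod\<close> appends the new factor on the right while
  \<open>finprod_insert\<close> puts it on the left; commutativity in the cone reconciles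
  them.\<close>

lemma mat_prod_eq_finprod:
  assumes "\<And>i. i \<in> {1..n} \<Longrightarrow> F i \<in> carrier (psd_cone d S)"
  shows "mat_prod d F n = finprod (psd_cone d S) F {1..n}"
  using assms
proof (induction n)
  case 0
  then show ?case by simp
next
  case (Suc n)
  have "{1..Suc n} = insert (Suc n) {1..n}" by auto
  moreover have "finprod (psd_cone d S) F (insert (Suc n) {1..n})
      = F (Suc n) * finprod (psd_cone d S) F {1..n}"
    using Suc.prems finprod_insert[of "{1..n}" "Suc n" F] by (auto simp: Pi_def)
  moreover have "F (Suc n) * finprod (psd_cone d S) F {1..n}
      = finprod (psd_cone d S) F {1..n} * F (Suc n)"
    using Suc.prems m_comm[of "F (Suc n)" "finprod (psd_cone d S) F {1..n}"]
    by (auto simp: Pi_def)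
  ultimately show ?case using Suc by simp
qed

lemma loewner_le_iff:
  assumes "M \<in> carrier (psd_cone d S)" "N \<in> carrier (psd_cone d S)"
  shows "M \<preceq>\<^sub>L N \<longleftrightarrow> psd_mat (N - M)"
  using psd_coneD[OF assms(1)] psd_coneD[OF assms(2)] by (auto simp: loewner_le_def)

text \<open>The difference of the two products is \<open>z * (y - x)\<close>. Since
  \<open>y - x\<close> stays in the double commutant, it commutes with \<open>z\<close>, and the
  product of the two is positive semidefinite.\<close>

lemma loewner_le_mult_left:
  assumes xyz: "x \<in> carrier (psd_cone d S)" "y \<in> carrier (psd_cone d S)" "z \<in> carrier (psd_cone d S)"
    and le: "x \<preceq>\<^sub>L y"
  shows "z * x \<preceq>\<^sub>L z * y"
proof -
  note c = xyz[THEN psd_coneD(1)] xyz[THEN psd_coneD(4)]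
  have "y - x \<in> commutant d (commutant d S)"
    using c by (intro commutant_minus[OF commutant_carrier])
  then have "psd_mat (z * (y - x))"
    using c double_commutant_comm le minus_carrier_mat[of x d d y] psd_coneD(2)[OF xyz(3)]
    by (intro commuting_psd_mult[of _ d]) (auto simp: loewner_le_def)
  then show ?thesis
    using c xyz psd_cone_mult by (simp add: loewner_le_iff mult_minus_distrib_mat[of _ d d _ d])
qed

text \<open>The difference of the two sides is \<open>(a' - a) * (b' - b)\<close>.\<close>

lemma loewner_le_swap:
  assumes cone: "a \<in> carrier (psd_cone d S)" "a' \<in> carrier (psd_cone d S)"
      "b \<in> carrier (psd_cone d S)" "b' \<in> carrier (psd_cone d S)"
    and a: "psd_mat (a' - a)" and b: "psd_mat (b' - b)"
  shows "(a + b) * (a' + b') \<preceq>\<^sub>L (a + b') * (a' + b)"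
proof -
  note c = cone[THEN psd_coneD(1)] and dc = cone[THEN psd_coneD(4)]
  have "a' - a \<in> commutant d (commutant d S)" "b' - b \<in> commutant d (commutant d S)"
    using dc by (auto intro!: commutant_minus[OF commutant_carrier])
  then have "psd_mat ((a' - a) * (b' - b))"
    using a b double_commutant_comm c by (intro commuting_psd_mult[of _ d]) auto
  moreover have "(a + b') * (a' + b) - (a + b) * (a' + b') = (a' - a) * (b' - b)"
  proof -
    have ba: "b * a' = a' * b" "b' * a' = a' * b'" "b' * b = b * b'"
      using dc double_commutant_comm by auto
    have "(a + b') * (a' + b) = a * a' + a * b + (a' * b' + b * b')"
      using c add_mult_distrib_mat[of a d d b' "a' + b" d] by (simp add: mult_add_distrib_mat[of _ d d _ d] ba)
    moreover have "(a + b) * (a' + b') = a * a' + a * b' + (a' * b + b * b')"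
      using c add_mult_distrib_mat[of a d d b "a' + b'" d] by (simp add: mult_add_distrib_mat[of _ d d _ d] ba)
    moreover have "(a' - a) * (b' - b) = (a' * b' - a' * b) - (a * b' - a * b)"
      using c minus_mult_distrib_mat[of a' d d a "b' - b" d] minus_carrier_mat[of b d d b']
      by (simp add: mult_minus_distrib_mat[of _ d d _ d])
    \<comment> \<open>The terms \<open>a * a'\<close> and \<open>b * b'\<close> cancel. With
      \<open>index_mult_mat(1)\<close> removed, entries of products remain atoms and the identity is
      linear in them.\<close>
    moreover have "a * a' + a * b + (a' * b' + b * b') - (a * a' + a * b' + (a' * b + b * b'))
        = (a' * b' - a' * b) - (a * b' - a * b)"
      using c by (intro eq_matI) (auto simp del: index_mult_mat(1))
    ultimately show ?thesis by metis
  qed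
  ultimately show ?thesis
    using cone by (simp add: loewner_le_iff psd_cone_add psd_cone_mult)
qed

lemma loewner_le_trans:
  assumes xyz: "x \<in> carrier (psd_cone d S)" "y \<in> carrier (psd_cone d S)" "z \<in> carrier (psd_cone d S)"
    and le: "x \<preceq>\<^sub>L y" "y \<preceq>\<^sub>L z"
  shows "x \<preceq>\<^sub>L z"
proof -
  note c = xyz[THEN psd_coneD(1)]
  have "psd_mat ((z - y) + (y - x))"
    using c le by (intro psd_add[of _ d]) (auto simp: loewner_le_def)
  moreover have "(z - y) + (y - x) = z - x"
    using c by (intro eq_matI) auto
  ultimately show ?thesis using xyz by (simp add: loewner_le_iff)
qed

lemma loewner_le_refl:
  assumes "x \<in> carrier (psd_cone d S)"
  shows "x \<preceq>\<^sub>L x"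
proof -
  have "psd_mat (0\<^sub>m d d)"
    using psd_one by (intro psd_matI[of _ d]) (auto simp: hermitian_mat_iff scalar_prod_def)
  then show ?thesis
    using assms psd_coneD(1)[OF assms] by (simp add: loewner_le_iff minus_r_inv_mat)
qed

end

section \<open>Monotone chains and the two bounds\<close>

text \<open>The difference telescopes into consecutive ones. Because \<open>i < j\<close> is strict,
  the induction starts at \<open>Suc i\<close>, where the claim is a single link of the
  chain.\<close>

lemma loewner_chain:
  fixes A :: "nat \<Rightarrow> complex mat"
  assumes carrier: "\<And>i. i \<in> {1..n} \<Longrightarrow> A i \<in> carrier_mat d d"
    and chain: "\<And>i. i \<in> {1..<n} \<Longrightarrow> A i \<preceq>\<^sub>L A (i + 1)"
    and i: "1 \<le> i" "i < j" "j \<le> n"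
  shows "psd_mat (A j - A i)"
proof -
  have "Suc i \<le> j" using i by simp
  then show ?thesis using i(3)
  proof (induction j rule: dec_induct)
    case base
    then show ?case using chain[of i] i by (simp add: loewner_le_def)
  next
    case (step k)
    have c: "A (Suc k) \<in> carrier_mat d d" "A k \<in> carrier_mat d d" "A i \<in> carrier_mat d d"
      using step i by (auto intro!: carrier)
    have "psd_mat ((A (Suc k) - A k) + (A k - A i))"
      using chain[of k] step i c by (intro psd_add[of _ d]) (auto simp: loewner_le_def)
    moreover have "(A (Suc k) - A k) + (A k - A i) = A (Suc k) - A i"
      using c by (intro eq_matI) auto
    ultimately show ?case by simp
  qed
qed

lemma loewner_chain_psd:
  fixes A :: "nat \<Rightarrow> complex mat"
  assumes carrier: "\<And>i. i \<in> {1..n} \<Longrightarrow> A i \<in> carrier_mat d d"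
    and nonneg: "0\<^sub>m d d \<preceq>\<^sub>L A 1"
    and chain: "\<And>i. i \<in> {1..<n} \<Longrightarrow> A i \<preceq>\<^sub>L A (i + 1)"
    and i: "i \<in> {1..n}"
  shows "psd_mat (A i)"
proof -
  have c: "A 1 \<in> carrier_mat d d" "A i \<in> carrier_mat d d" using carrier i by auto
  have "A 1 - 0\<^sub>m d d = A 1" using c by (intro eq_matI) auto
  then have p1: "psd_mat (A 1)" using nonneg by (simp add: loewner_le_def)
  show ?thesis
  proof (cases "i = 1")
    case False
    have "psd_mat ((A i - A 1) + A 1)"
      using loewner_chain[of n A d 1 i] carrier chain i False p1 c minus_carrier_mat[OF c(1)]
      by (intro psd_add[of _ d]) auto
    moreover have "(A i - A 1) + A 1 = A i"
      using c by (intro eq_matI) auto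
    ultimately show ?thesis by simp
  qed (use p1 in simp)
qed

theorem theorem27:
  fixes d n :: nat
    and A B :: "nat \<Rightarrow> complex mat"
  assumes n: "n \<ge> 1"
    and A_carrier: "\<And>i. i \<in> {1..n} \<Longrightarrow> A i \<in> carrier_mat d d"
    and B_carrier: "\<And>i. i \<in> {1..n} \<Longrightarrow> B i \<in> carrier_mat d d"
    and A_hermitian: "\<And>i. i \<in> {1..n} \<Longrightarrow> hermitian_mat (A i)"
    and B_hermitian: "\<And>i. i \<in> {1..n} \<Longrightarrow> hermitian_mat (B i)"
    and A_nonneg: "0\<^sub>m d d \<preceq>\<^sub>L A 1"
    and A_chain: "\<And>i. i \<in> {1..<n} \<Longrightarrow> A i \<preceq>\<^sub>L A (i + 1)"
    and B_nonneg: "0\<^sub>m d d \<preceq>\<^sub>L B 1"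
    and B_chain: "\<And>i. i \<in> {1..<n} \<Longrightarrow> B i \<preceq>\<^sub>L B (i + 1)"
    and AA_commute: "\<And>i j. i \<in> {1..n} \<Longrightarrow> j \<in> {1..n} \<Longrightarrow> A i * A j = A j * A i"
    and AB_commute: "\<And>i j. i \<in> {1..n} \<Longrightarrow> j \<in> {1..n} \<Longrightarrow> A i * B j = B j * A i"
    and BB_commute: "\<And>i j. i \<in> {1..n} \<Longrightarrow> j \<in> {1..n} \<Longrightarrow> B i * B j = B j * B i"
  shows "\<forall>\<sigma>. \<sigma> permutes {1..n} \<longrightarrow>
           mat_prod d (\<lambda>i. A i + B (n - i + 1)) n \<succeq>\<^sub>L mat_prod d (\<lambda>i. A i + B (\<sigma> i)) n \<and>
           mat_prod d (\<lambda>i. A i + B (\<sigma> i)) n \<succeq>\<^sub>L mat_prod d (\<lambda>i. A i + B i) n"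
proof (intro allI impI conjI)
  fix \<sigma> :: "nat \<Rightarrow> nat" assume \<sigma>: "\<sigma> permutes {1..n}"
  \<comment> \<open>Both families enter one set, so that all sums \<open>A i + B j\<close> lie in
    the same cone.\<close>
  define S where "S = A ` {1..n} \<union> B ` {1..n}"
  interpret commuting_family d S
  proof
    show "S \<subseteq> commutant d S"
      using A_carrier B_carrier AA_commute AB_commute BB_commute
      by (auto simp: S_def commutant_def)
  qed
  have A: "A i \<in> carrier (psd_cone d S)" and B: "B i \<in> carrier (psd_cone d S)"
    if i: "i \<in> {1..n}" for i
  proof -
    have "psd_mat (A i)"
      by (rule loewner_chain_psd[of n A d i]) (fact A_carrier A_nonneg A_chain i)+
    moreover have "psd_mat (B i)"
      by (rule loewner_chain_psd[of n B d i]) (fact B_carrier B_nonneg B_chain i)+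
    moreover have "A i \<in> S" "B i \<in> S" using i by (auto simp: S_def)
    ultimately show "A i \<in> carrier (psd_cone d S)" "B i \<in> carrier (psd_cone d S)"
      by (simp_all add: carrier_psd_cone in_double_commutant)
  qed
  have A_mono: "psd_mat (A j - A i)" and B_mono: "psd_mat (B j - B i)"
    if ij: "1 \<le> i" "i < j" "j \<le> n" for i j
  proof -
    show "psd_mat (A j - A i)"
      by (rule loewner_chain[of n A d i j]) (fact A_carrier A_chain ij)+
    show "psd_mat (B j - B i)"
      by (rule loewner_chain[of n B d i j]) (fact B_carrier B_chain ij)+
  qed
  have AB: "A i + B j \<in> carrier (psd_cone d S)" if "i \<in> {1..n}" "j \<in> {1..n}" for i j
    using that A B by (intro psd_cone_add)
  have \<sigma>_in: "\<sigma> i \<in> {1..n}" if "i \<in> {1..n}" for i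
    using permutes_in_image[OF \<sigma>] that by blast
  have prod: "mat_prod d (\<lambda>i. A i + B (f i)) n = finprod (psd_cone d S) (\<lambda>i. A i + B (f i)) {1..n}"
    if "\<And>i. i \<in> {1..n} \<Longrightarrow> f i \<in> {1..n}" for f
    using that by (intro mat_prod_eq_finprod AB)

  have "finprod (psd_cone d S) (\<lambda>i. A i + B i) {1..n}
      \<preceq>\<^sub>L finprod (psd_cone d S) (\<lambda>i. A i + B (\<sigma> i)) {1..n}"
  proof (rule finprod_rearrangement[where R = "(\<preceq>\<^sub>L)" and F = "\<lambda>i j. A i + B j"])
    fix i k m assume "i \<in> {1..<m}" "k \<in> {1..<m}" "m \<in> {1..n}"
    then show "(A i + B k) \<otimes>\<^bsub>psd_cone d S\<^esub> (A m + B m)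
        \<preceq>\<^sub>L (A i + B m) \<otimes>\<^bsub>psd_cone d S\<^esub> (A m + B k)"
      using A B A_mono B_mono by (auto intro!: loewner_le_swap)
  next
    show "x \<preceq>\<^sub>L z" if "x \<in> carrier (psd_cone d S)" "y \<in> carrier (psd_cone d S)"
      "z \<in> carrier (psd_cone d S)" "x \<preceq>\<^sub>L y" "y \<preceq>\<^sub>L z" for x y z
      using that by (rule loewner_le_trans)
  qed (simp_all add: \<sigma>[simplified] AB loewner_le_refl loewner_le_mult_left)
  then show "mat_prod d (\<lambda>i. A i + B i) n \<preceq>\<^sub>L mat_prod d (\<lambda>i. A i + B (\<sigma> i)) n"
    using prod[of "\<lambda>i. i"] prod[of \<sigma>, OF \<sigma>_in] by simp

  have rev_in: "n - i + 1 \<in> {1..n}" if "i \<in> {1..n}" for i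
    using that by auto
  \<comment> \<open>The reversal of the index range, extended by the identity because
    \<open>permutes\<close> demands fixed points outside.\<close>
  define \<rho> where "\<rho> i = (if i \<in> {1..n} then n - i + 1 else i)" for i
  have "bij_betw \<rho> {1..n} {1..n}"
    by (rule bij_betwI[of _ _ _ \<rho>]) (auto simp: \<rho>_def)
  then have "\<rho> permutes {1..n}"
    by (intro bij_imp_permutes) (auto simp: \<rho>_def)
  then have \<rho>\<sigma>: "\<rho> \<circ> \<sigma> permutes {1..n}"
    by (rule permutes_compose[OF \<sigma>])
  \<comment> \<open>With the \<open>B\<close> sequence reversed, the diagonal arrangement is the
    oppositely ordered product. The permutation \<open>\<rho> \<circ> \<sigma>\<close> is chosen so
    that the two reversals cancel and the arrangement given by \<sigma> reappears.\<close>
  have "finprod (psd_cone d S) (\<lambda>i. A i + B (n - (\<rho> \<circ> \<sigma>) i + 1)) {1..n}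
      \<preceq>\<^sub>L finprod (psd_cone d S) (\<lambda>i. A i + B (n - i + 1)) {1..n}"
  proof (rule finprod_rearrangement[where R = "(\<succeq>\<^sub>L)" and F = "\<lambda>i j. A i + B (n - j + 1)"])
    fix i k m assume *: "i \<in> {1..<m}" "k \<in> {1..<m}" "m \<in> {1..n}"
    \<comment> \<open>Reversal turns \<open>k < m\<close> into the opposite inequality between the
      indices of \<open>B\<close>. The diagonal pair is now the oppositely ordered one, which is why
      \<open>R\<close> is the converse order here.\<close>
    then have "n - k + 1 \<in> {1..n}" "n - m + 1 \<in> {1..n}" "n - m + 1 < n - k + 1" by auto
    with * show "(A i + B (n - m + 1)) \<otimes>\<^bsub>psd_cone d S\<^esub> (A m + B (n - k + 1))
        \<preceq>\<^sub>L (A i + B (n - k + 1)) \<otimes>\<^bsub>psd_cone d S\<^esub> (A m + B (n - m + 1))"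
      using A B A_mono B_mono by (auto intro!: loewner_le_swap)
  next
    show "z \<preceq>\<^sub>L x" if "x \<in> carrier (psd_cone d S)" "y \<in> carrier (psd_cone d S)"
      "z \<in> carrier (psd_cone d S)" "y \<preceq>\<^sub>L x" "z \<preceq>\<^sub>L y" for x y z
      using that(3,2,1,5,4) by (rule loewner_le_trans)
  next
    show "A i + B (n - j + 1) \<in> carrier (psd_cone d S)" if "i \<in> {1..n}" "j \<in> {1..n}" for i j
      using that by (intro AB) auto
  qed (simp_all add: \<rho>\<sigma>[unfolded o_def, simplified] loewner_le_refl loewner_le_mult_left)
  moreover have "finprod (psd_cone d S) (\<lambda>i. A i + B (n - (\<rho> \<circ> \<sigma>) i + 1)) {1..n}
      = finprod (psd_cone d S) (\<lambda>i. A i + B (\<sigma> i)) {1..n}"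
  proof (intro finprod_cong')
    show "A i + B (n - (\<rho> \<circ> \<sigma>) i + 1) = A i + B (\<sigma> i)" if "i \<in> {1..n}" for i
      using \<sigma>_in[OF that] by (simp add: \<rho>_def)
  qed (use \<sigma>_in AB in auto)
  ultimately show "mat_prod d (\<lambda>i. A i + B (\<sigma> i)) n \<preceq>\<^sub>L mat_prod d (\<lambda>i. A i + B (n - i + 1)) n"
    using prod[of "\<lambda>i. n - i + 1", OF rev_in] prod[of \<sigma>, OF \<sigma>_in] by simp
qed

end
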